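(* Assume that $A\cap \operatorname{dom} f\neq\emptyset$ and that $\operatorname{epi} f^{*}+K$ is weak$^{*}$-closed in $X^{*}\times\mathbb{R}$. Then, for each $(x^{*},s)\in X^{*}\times\mathbb{R}$, the following statements are equivalent: (i) for every $x\in C$ with $f_i(x)\le 0$ for all $i\in I$, one has $f(x)-\langle x^{*},x\rangle\ge s$; (ii) there exist $J\in\mathcal{J}$, $u_j^{*}\in\operatorname{dom} f_j^{*}$ and $\lambda_j\ge 0$ for all $j\in J$, $u^{*}\in\operatorname{dom} f^{*}$ and $v^{*}\in\operatorname{barr} C$ such that $$x^{*}=u^{*}+v^{*}+\sum_{j\in J}\lambda_j u_j^{*}\quad\text{and}\quad f^{*}(u^{*})+\delta_C^{*}(v^{*})+\sum_{j\in J}\lambda_j f_j^{*}(u_j^{*})\le -s;$$ (iii) there exist $J\in\mathcal{J}$ and $\lambda_i\ge 0$ for all $i\in J$ such that $$f(x)-\langle x^{*},x\rangle+\sum_{i\in J}\lambda_i f_i(x)\ge s\quad\text{for all } x\in C.$$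
   Context: $X$ is a real locally convex Hausdorff topological vector space with topological dual $X^{*}$. $X^{*}$ carries the weak$^{*}$ topology, and weak$^{*}$-closedness in $X^{*}\times\mathbb{R}$ refers to the corresponding product topology. $\Gamma(X)$ is the set of proper (never $-\infty$, not identically $+\infty$) lower semicontinuous convex functions $X\to\mathbb{R}\cup\{+\infty\}$. Data: $I$ is an arbitrary nonempty (possibly infinite) index set, $C\subset X$ is a nonempty closed convex set, $f_i\in\Gamma(X)$ for each $i\in I$, and $f\in\Gamma(X)$. $A:=\{x\in C: f_i(x)\le 0\ \forall i\in I\}$. $\mathcal{J}$ is the collection of all nonempty finite subsets of $I$. Notation: $\operatorname{dom} h=\{h<+\infty\}$; $\operatorname{epi} h=\{(x,r): r\in\mathbb{R},\ h(x)\le r\}$; $h^{*}(x^{*})=\sup_{x\in X}(\langle x^{*},x\rangle-h(x))$; $\delta_D$ is the indicator of $D$ ($0$ on $D$, $+\infty$ elsewhere); $\operatorname{barr} C=\operatorname{dom}\delta_C^{*}$; $\operatorname{cone} D$ is the convex cone generated by $D\cup\{0\}$. The characteristic cone is $K:=\operatorname{cone}\big(\operatorname{epi}\delta_C^{*}\cup\bigcup_{i\in I}\operatorname{epi} f_i^{*}\big)\subset X^{*}\times\mathbb{R}$. In sums $\sum_{j\in J}\lambda_j f_j(x)$ the rule $0\times(+\infty)=0$ is adopted. *)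

theory Defs
  imports "HOL-Analysis.Analysis" "HOL-Library.Set_Algebras"
begin

section \<open>Locally convex Hausdorff spaces\<close>

text \<open>
  The last axiom says that the convex open sets form a basis; \<open>convex V\<close> is written out because
  \<^const>\<open>convex\<close> is not available inside a class specification.
\<close>

class locally_convex_space = real_vector + topological_ab_group_add + t2_space +
  assumes tendsto_scaleR_nhds:
    "((\<lambda>p. fst p *\<^sub>R snd p) \<longlongrightarrow> c *\<^sub>R a) (nhds c \<times>\<^sub>F nhds a)"
  and locally_convex_unfolded:
    "open U \<Longrightarrow> a \<in> U \<Longrightarrow> \<exists>V. open V \<and> a \<in> V \<and> V \<subseteq> U \<and>
       (\<forall>x\<in>V. \<forall>y\<in>V. \<forall>u\<ge>0. \<forall>v\<ge>0. u + v = 1 \<longrightarrow> u *\<^sub>R x + v *\<^sub>R y \<in> V)"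

lemma locally_convex:
  fixes a :: "'a::locally_convex_space"
  assumes "open U" "a \<in> U"
  obtains V where "open V" "convex V" "a \<in> V" "V \<subseteq> U"
  using locally_convex_unfolded[OF assms] unfolding convex_def by blast

instance real_normed_vector \<subseteq> locally_convex_space
proof
  fix c :: real and a :: 'a
  show "((\<lambda>p. fst p *\<^sub>R snd p) \<longlongrightarrow> c *\<^sub>R a) (nhds c \<times>\<^sub>F nhds a)"
    by (intro tendsto_intros filterlim_fst filterlim_snd)
next
  fix U :: "'a set" and a :: 'a
  assume "open U" "a \<in> U"
  then obtain e where "e > 0" "ball a e \<subseteq> U"
    by (meson open_contains_ball)
  then show "\<exists>V. open V \<and> a \<in> V \<and> V \<subseteq> U \<and>
       (\<forall>x\<in>V. \<forall>y\<in>V. \<forall>u\<ge>0. \<forall>v\<ge>0. u + v = 1 \<longrightarrow> u *\<^sub>R x + v *\<^sub>R y \<in> V)"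
    using convex_ball[of a e] unfolding convex_def
    by (intro exI[of _ "ball a e"]) auto
qed


section \<open>The topological dual with the weak* topology\<close>

typedef (overloaded) 'a dual =
  "{u :: 'a::locally_convex_space \<Rightarrow> real. linear u \<and> continuous_on UNIV u}"
  morphisms dual_apply Abs_dual
  by (rule exI[of _ "\<lambda>_. 0"]) (simp add: linear_iff)

setup_lifting type_definition_dual

instantiation dual :: (locally_convex_space) real_vector
begin

lift_definition zero_dual :: "'a dual" is "\<lambda>_. 0"
  by (simp add: linear_iff)

lift_definition plus_dual :: "'a dual \<Rightarrow> 'a dual \<Rightarrow> 'a dual" is "\<lambda>u v x. u x + v x"
  by (simp add: linear_iff algebra_simps continuous_on_add)

lift_definition uminus_dual :: "'a dual \<Rightarrow> 'a dual" is "\<lambda>u x. - u x"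
  by (simp add: linear_iff continuous_on_minus)

lift_definition minus_dual :: "'a dual \<Rightarrow> 'a dual \<Rightarrow> 'a dual" is "\<lambda>u v x. u x - v x"
  by (simp add: linear_iff algebra_simps continuous_on_diff)

lift_definition scaleR_dual :: "real \<Rightarrow> 'a dual \<Rightarrow> 'a dual" is "\<lambda>c u x. c * u x"
  by (simp add: linear_iff algebra_simps continuous_on_mult_left)

instance
  by standard (transfer; simp add: fun_eq_iff algebra_simps)+

end

text \<open>
  The coarsest topology making every evaluation \<open>u \<mapsto> \<langle>u, x\<rangle>\<close> continuous. On \<open>'a dual \<times> real\<close> the
  library's product instance then gives the topology in which weak*-closedness is meant.
\<close>

instantiation dual :: (locally_convex_space) topological_space
begin

definition open_dual :: "'a dual set \<Rightarrow> bool" where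
  "open_dual = generate_topology {(\<lambda>u. dual_apply u x) -` V | x V. open V}"

instance
  by standard (auto simp: open_dual_def intro: generate_topology.intros)

end


section \<open>Extended-real-valued functions\<close>

text \<open>
  Functions into \<open>\<real> \<union> {+\<infinity>}\<close> are \<open>ereal\<close>-valued functions; the value \<open>-\<infinity>\<close> is excluded by
  \<open>proper_fun\<close>. In \<open>ereal\<close> one has \<open>0 * \<infinity> = 0\<close>.
\<close>

definition proper_fun :: "('a \<Rightarrow> ereal) \<Rightarrow> bool" where
  "proper_fun h \<longleftrightarrow> (\<forall>x. h x \<noteq> -\<infinity>) \<and> (\<exists>x. h x \<noteq> \<infinity>)"

definition lower_semicontinuous :: "('a::topological_space \<Rightarrow> ereal) \<Rightarrow> bool" where
  "lower_semicontinuous h \<longleftrightarrow> (\<forall>x. \<forall>r < h x. \<forall>\<^sub>F y in nhds x. r < h y)"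

text \<open>Only used for functions without the value \<open>-\<infinity>\<close>, so \<open>\<infinity> + (-\<infinity>)\<close> never arises.\<close>

definition convex_fun :: "('a::real_vector \<Rightarrow> ereal) \<Rightarrow> bool" where
  "convex_fun h \<longleftrightarrow> (\<forall>x y. \<forall>t\<in>{0<..<1}.
     h ((1 - t) *\<^sub>R x + t *\<^sub>R y) \<le> ereal (1 - t) * h x + ereal t * h y)"

definition Gamma_fun :: "('a::locally_convex_space \<Rightarrow> ereal) set" where
  "Gamma_fun = {h. proper_fun h \<and> lower_semicontinuous h \<and> convex_fun h}"

definition eff_dom :: "('b \<Rightarrow> ereal) \<Rightarrow> 'b set" where
  "eff_dom h = {x. h x < \<infinity>}"

definition epi :: "('b \<Rightarrow> ereal) \<Rightarrow> ('b \<times> real) set" where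
  "epi h = {(x, r). h x \<le> ereal r}"

definition conjugate :: "('a::locally_convex_space \<Rightarrow> ereal) \<Rightarrow> 'a dual \<Rightarrow> ereal" where
  "conjugate h u = (SUP x. ereal (dual_apply u x) - h x)"

definition indicator_fun :: "'a set \<Rightarrow> 'a \<Rightarrow> ereal" where
  "indicator_fun D x = (if x \<in> D then 0 else \<infinity>)"

definition barr :: "'a::locally_convex_space set \<Rightarrow> 'a dual set" where
  "barr D = eff_dom (conjugate (indicator_fun D))"


section \<open>The constraint system\<close>

definition feasible_set :: "'a set \<Rightarrow> 'i set \<Rightarrow> ('i \<Rightarrow> 'a \<Rightarrow> ereal) \<Rightarrow> 'a set" where
  "feasible_set C I g = {x \<in> C. \<forall>i\<in>I. g i x \<le> 0}"

definition cone_gen :: "'b::real_vector set \<Rightarrow> 'b set" where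
  "cone_gen D = convex_cone hull (D \<union> {0})"

definition char_cone ::
  "'a::locally_convex_space set \<Rightarrow> 'i set \<Rightarrow> ('i \<Rightarrow> 'a \<Rightarrow> ereal) \<Rightarrow> ('a dual \<times> real) set" where
  "char_cone C I g =
     cone_gen (epi (conjugate (indicator_fun C)) \<union> (\<Union>i\<in>I. epi (conjugate (g i))))"

end

theory Submission
  imports Defs
begin

text \<open>
  The lower bound \<open>s\<close> for \<open>f - xs\<close> on the feasible set is one inequality about the conjugate of \<open>f\<close> plus the
  indicator of that set: it says that \<open>(xs, - s)\<close> lies in the epigraph of this conjugate. As \<open>f\<close> is
  finite at some feasible point, this epigraph is the weak* closure of \<open>epi f\<^sup>* + K\<close>, where \<open>K\<close> is the characteristic
  cone; when \<open>epi f\<^sup>* + K\<close> is closed, \<open>(xs, - s)\<close> is therefore a sum of an element of \<open>epi f\<^sup>*\<close> and an element of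
  \<open>K\<close> (\<open>mem_epi_conjugate_plus_char_cone\<close>). Writing the element of \<open>K\<close> as a point of the epigraph of the
  support function of \<open>C\<close> plus finitely many nonnegative multiples of points of the epigraphs of the
  conjugates of the \<open>g j\<close> (\<open>char_cone_decomposition\<close>) yields the multipliers of the second
  condition. Those give the Lagrangian bound by adding Fenchel-Young inequalities
  (\<open>lagrangian_bound_if_multipliers\<close>), and the Lagrangian bound implies the lower bound since the
  constraint terms are nonpositive at feasible points.

  The first implication is a separation argument in \<open>X\<^sup>* \<times> \<real>\<close>. A point outside \<open>epi f\<^sup>* + K\<close> can be
  separated from it by the evaluation at some \<open>w \<in> X\<close>; nonpositivity on \<open>K\<close> makes \<open>w\<close> feasible and the
  part over \<open>epi f\<^sup>*\<close> makes \<open>f w\<close> too small. Both conclusions pass from conjugates back to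
  functions and rest on the Fenchel-Moreau theorem (\<open>fenchel_moreau\<close>), itself a separation
  argument in \<open>X \<times> \<real>\<close>. Both separations come from one algebraic fact, the Mazur-Orlicz theorem
  (\<open>mazur_orlicz\<close>), applied to a different sublinear functional: the gauge of a convex neighbourhood in
  \<open>X\<close>, combined with the real coordinate, and a finite sum of absolute values of evaluations on \<open>X\<^sup>*\<close>. In
  both cases the hyperplane obtained may be vertical, and \<open>nonvertical_separation\<close> tilts it.
\<close>


section \<open>Sublinear functionals and the Mazur-Orlicz theorem\<close>

text \<open>
  The inequality \<open>q (t x) \<le> t * q x\<close> for \<open>t > 0\<close> alone is the cheapest form to verify for infima;
  applied to \<open>1/t\<close> it gives the reverse inequality, and then \<open>q 0 = 0\<close>.
\<close>

definition sublinear :: "('v::real_vector \<Rightarrow> real) \<Rightarrow> bool" where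
  "sublinear q \<longleftrightarrow> (\<forall>x y. q (x + y) \<le> q x + q y) \<and> (\<forall>x. \<forall>t>0. q (t *\<^sub>R x) \<le> t * q x)"

lemma sublinear_add: "sublinear q \<Longrightarrow> q (x + y) \<le> q x + q y"
  by (simp add: sublinear_def)

lemma sublinear_scaleR:
  assumes "sublinear q" "t > 0"
  shows "q (t *\<^sub>R x) = t * q x"
proof (rule antisym)
  show "q (t *\<^sub>R x) \<le> t * q x"
    using assms by (simp add: sublinear_def)
  have "q (inverse t *\<^sub>R (t *\<^sub>R x)) \<le> inverse t * q (t *\<^sub>R x)"
    using assms unfolding sublinear_def by (meson positive_imp_inverse_positive)
  then show "t * q x \<le> q (t *\<^sub>R x)"
    using assms by (simp add: field_simps)
qed

lemma sublinear_0:
  assumes "sublinear q"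
  shows "q 0 = 0"
  using sublinear_scaleR[OF assms, of 2 0] by simp

lemma sublinear_ge_uminus:
  assumes "sublinear q"
  shows "- q (- x) \<le> q x"
  using sublinear_add[OF assms, of x "- x"] sublinear_0[OF assms] by simp

text \<open>
  Zorn's lemma, in the pointwise order. A chain below \<open>q\<close> has a pointwise infimum because each of
  its members \<open>p\<close> satisfies \<open>p x \<ge> - p (- x) \<ge> - q (- x)\<close>. The infimum stays subadditive because two
  members of a chain can be replaced by the smaller of them. Minimality is what will force
  linearity in the Mazur-Orlicz theorem, so no functional has to be extended from subspace to
  subspace.
\<close>

lemma exists_minimal_sublinear:
  fixes q :: "'v::real_vector \<Rightarrow> real"
  assumes "sublinear q"
  obtains m where "sublinear m" "m \<le> q" "\<And>p. sublinear p \<Longrightarrow> p \<le> m \<Longrightarrow> p = m"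
proof -
  define A where "A = {p. sublinear p \<and> p \<le> q}"
  define P where "P = (\<lambda>(a::'v \<Rightarrow> real) b. b \<le> a)"
  have po: "partial_order_on A (relation_of P A)"
    by (rule partial_order_on_relation_ofI) (auto simp: P_def)
  have "\<exists>u\<in>A. \<forall>a\<in>\<C>. P a u" if \<C>: "\<C> \<in> Chains (relation_of P A)" for \<C>
  proof (cases "\<C> = {}")
    case True
    then show ?thesis
      using assms by (intro bexI[of _ q]) (auto simp: A_def)
  next
    case False
    have sub: "\<C> \<subseteq> A"
      using \<C> by (auto simp: Chains_def relation_of_def)
    have total: "a \<le> b \<or> b \<le> a" if "a \<in> \<C>" "b \<in> \<C>" for a b
      using \<C> that by (auto simp: Chains_def relation_of_def P_def)
    have sl: "sublinear p" and le: "p \<le> q" if "p \<in> \<C>" for p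
      using sub that by (auto simp: A_def)
    define u where "u x = (INF p\<in>\<C>. p x)" for x
    have bdd: "bdd_below ((\<lambda>p. p x) ` \<C>)" for x
    proof (rule bdd_belowI2)
      fix p assume p: "p \<in> \<C>"
      have "- q (- x) \<le> - p (- x)"
        using le[OF p] by (simp add: le_fun_def)
      also have "\<dots> \<le> p x"
        using sublinear_ge_uminus[OF sl[OF p]] .
      finally show "- q (- x) \<le> p x" .
    qed
    have u_le: "u x \<le> p x" if "p \<in> \<C>" for p x
      unfolding u_def by (rule cINF_lower[OF bdd that])
    have u_ge: "c \<le> u x" if "\<And>p. p \<in> \<C> \<Longrightarrow> c \<le> p x" for c x
      unfolding u_def by (rule cINF_greatest[OF False]) (rule that)
    have add2: "u (x + y) \<le> p x + r y" if p: "p \<in> \<C>" and r: "r \<in> \<C>" for p r x y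
    proof -
      \<comment> \<open>evaluate at the smaller of the two members of the chain\<close>
      obtain w where w: "w \<in> \<C>" "w \<le> p" "w \<le> r"
        using total[OF p r] p r by blast
      have "u (x + y) \<le> w x + w y"
        using u_le[OF w(1)] sublinear_add[OF sl[OF w(1)]] by (meson order_trans)
      also have "\<dots> \<le> p x + r y"
        using w by (auto simp: le_fun_def intro: add_mono)
      finally show ?thesis .
    qed
    have "u (x + y) - p x \<le> u y" if "p \<in> \<C>" for p x y
      by (rule u_ge) (use add2[OF that] in \<open>simp add: algebra_simps\<close>)
    then have "u (x + y) - u y \<le> u x" for x y
      by (intro u_ge) (simp add: algebra_simps)
    then have add: "u (x + y) \<le> u x + u y" for x y
      by (metis diff_le_eq)
    have "u (t *\<^sub>R x) / t \<le> u x" if "t > 0" for t x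
      by (rule u_ge)
        (use u_le sublinear_scaleR[OF sl that] that in \<open>metis mult.commute pos_divide_le_eq\<close>)
    then have "sublinear u"
      using add by (simp add: sublinear_def pos_divide_le_eq mult.commute)
    moreover have "u \<le> q"
    proof -
      obtain p where "p \<in> \<C>" using False by blast
      then show ?thesis
        using u_le[of p] le[of p] by (auto simp: le_fun_def intro: order_trans)
    qed
    ultimately show ?thesis
      using u_le by (intro bexI[of _ u]) (auto simp: A_def P_def le_fun_def)
  qed
  from predicate_Zorn[OF po this] obtain m where "m \<in> A" "\<And>a. a \<in> A \<Longrightarrow> P m a \<Longrightarrow> a = m"
    by blast
  then have "sublinear m" "m \<le> q" "\<And>p. sublinear p \<Longrightarrow> p \<le> m \<Longrightarrow> p = m"
    by (auto simp: A_def P_def)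
  then show thesis by (rule that)
qed

text \<open>
  The bound on \<open>- D\<close> is what makes every linear functional below \<open>p\<close> at least \<open>\<beta>\<close> on \<open>D\<close>. The
  witness is \<open>p x = inf {q (x + t d) - t \<beta> | t \<ge> 0, d \<in> D}\<close>. Convexity of \<open>D\<close> makes \<open>p\<close>
  subadditive, because \<open>t d + r e\<close>, for \<open>d\<close> and \<open>e\<close> in \<open>D\<close>, is again \<open>(t + r)\<close> times a point of \<open>D\<close>,
  and the lower bound \<open>\<beta>\<close> keeps the infimum finite.
\<close>

lemma sublinear_reduction:
  fixes q :: "'v::real_vector \<Rightarrow> real"
  assumes q: "sublinear q" and D: "convex D" "D \<noteq> {}" and \<beta>: "\<And>d. d \<in> D \<Longrightarrow> \<beta> \<le> q d"
  obtains p where "sublinear p" "p \<le> q" "\<And>d. d \<in> D \<Longrightarrow> p (- d) \<le> - \<beta>"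
proof -
  define T where "T = {0::real..} \<times> D"
  define p where "p x = (INF (t, d)\<in>T. q (x + t *\<^sub>R d) - t * \<beta>)" for x
  have T: "T \<noteq> {}" using D by (auto simp: T_def)
  have bdd: "bdd_below ((\<lambda>(t, d). q (x + t *\<^sub>R d) - t * \<beta>) ` T)" for x
  proof (rule bdd_belowI2, clarify)
    fix t d assume td: "(t, d) \<in> T"
    have "t * \<beta> \<le> q (t *\<^sub>R d)"
      using td \<beta>[of d] sublinear_scaleR[OF q, of t d] sublinear_0[OF q]
      by (cases "t = 0") (auto simp: T_def)
    also have "\<dots> \<le> q (x + t *\<^sub>R d) + q (- x)"
      using sublinear_add[OF q, of "x + t *\<^sub>R d" "- x"] by simp
    finally show "- q (- x) \<le> q (x + t *\<^sub>R d) - t * \<beta>" by simp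
  qed
  have p_le: "p x \<le> q (x + t *\<^sub>R d) - t * \<beta>" if "t \<ge> 0" "d \<in> D" for x t d
    unfolding p_def using that by (intro cINF_lower2[OF bdd, of "(t, d)"]) (auto simp: T_def)
  have p_ge: "c \<le> p x" if "\<And>t d. t \<ge> 0 \<Longrightarrow> d \<in> D \<Longrightarrow> c \<le> q (x + t *\<^sub>R d) - t * \<beta>" for c x
    unfolding p_def using that by (intro cINF_greatest[OF T]) (auto simp: T_def)
  have add2: "p (x + y) \<le> (q (x + t *\<^sub>R d) - t * \<beta>) + (q (y + r *\<^sub>R e) - r * \<beta>)"
    if t: "t \<ge> 0" "d \<in> D" and r: "r \<ge> 0" "e \<in> D" for x y t d r e
  proof -
    obtain w where w: "w \<in> D" "(t + r) *\<^sub>R w = t *\<^sub>R d + r *\<^sub>R e"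
    proof (cases "t + r = 0")
      case True
      then have "t = 0" "r = 0" using t r by linarith+
      then show ?thesis using t that[of d] by simp
    next
      case False
      then have pos: "t + r > 0" using t r by linarith
      then have "(t / (t + r)) *\<^sub>R d + (r / (t + r)) *\<^sub>R e \<in> D"
        using t r by (intro convexD[OF D(1)]) (auto simp flip: add_divide_distrib)
      then show ?thesis
        using pos by (intro that) (auto simp: scaleR_add_right)
    qed
    have "p (x + y) \<le> q ((x + y) + (t + r) *\<^sub>R w) - (t + r) * \<beta>"
      using t r w by (intro p_le) auto
    also have "(x + y) + (t + r) *\<^sub>R w = (x + t *\<^sub>R d) + (y + r *\<^sub>R e)"
      unfolding w(2) by simp
    also have "q \<dots> \<le> q (x + t *\<^sub>R d) + q (y + r *\<^sub>R e)"
      by (rule sublinear_add[OF q])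
    finally show ?thesis by (simp add: algebra_simps)
  qed
  have "p (x + y) - (q (x + t *\<^sub>R d) - t * \<beta>) \<le> p y" if "t \<ge> 0" "d \<in> D" for x y t d
    using add2[OF that] by (intro p_ge) (simp add: algebra_simps)
  then have "p (x + y) - p y \<le> p x" for x y
    by (intro p_ge) (simp add: algebra_simps)
  then have add: "p (x + y) \<le> p x + p y" for x y
    by (metis diff_le_eq)
  have "p (c *\<^sub>R x) / c \<le> p x" if c: "c > 0" for c x
  proof (rule p_ge)
    fix t d assume td: "t \<ge> (0::real)" "d \<in> D"
    have "p (c *\<^sub>R x) \<le> q (c *\<^sub>R x + (c * t) *\<^sub>R d) - (c * t) * \<beta>"
      using td c by (intro p_le) auto
    also have "c *\<^sub>R x + (c * t) *\<^sub>R d = c *\<^sub>R (x + t *\<^sub>R d)"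
      by (simp add: algebra_simps)
    finally have "p (c *\<^sub>R x) \<le> c * q (x + t *\<^sub>R d) - c * t * \<beta>"
      unfolding sublinear_scaleR[OF q c] .
    then show "p (c *\<^sub>R x) / c \<le> q (x + t *\<^sub>R d) - t * \<beta>"
      unfolding pos_divide_le_eq[OF c] by (simp add: algebra_simps)
  qed
  then have "sublinear p"
    using add by (simp add: sublinear_def pos_divide_le_eq mult.commute)
  moreover have "p \<le> q"
  proof (rule le_funI)
    fix x obtain d where "d \<in> D" using D by blast
    then show "p x \<le> q x" using p_le[of 0 d x] by simp
  qed
  moreover have "p (- d) \<le> - \<beta>" if "d \<in> D" for d
    using p_le[of 1 d "- d"] that sublinear_0[OF q] by simp
  ultimately show thesis by (rule that)
qed

text \<open>
  The form of the Hahn-Banach theorem used for both separations below: with \<open>q\<close> a gauge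
  of a neighbourhood of the origin that misses \<open>D\<close>, and \<open>\<beta> = 1\<close>, the functional \<open>\<phi>\<close> separates \<open>D\<close> from
  the origin, and \<open>\<phi> \<le> q\<close> provides its continuity.
\<close>

theorem mazur_orlicz:
  fixes q :: "'v::real_vector \<Rightarrow> real"
  assumes q: "sublinear q" and D: "convex D" "D \<noteq> {}" and \<beta>: "\<And>d. d \<in> D \<Longrightarrow> \<beta> \<le> q d"
  obtains \<phi> where "linear \<phi>" "\<And>x. \<phi> x \<le> q x" "\<And>d. d \<in> D \<Longrightarrow> \<beta> \<le> \<phi> d"
proof -
  obtain p where p: "sublinear p" "p \<le> q" "\<And>d. d \<in> D \<Longrightarrow> p (- d) \<le> - \<beta>"
    using sublinear_reduction[OF assms] by blast
  obtain \<phi> where \<phi>: "sublinear \<phi>" "\<phi> \<le> p" and min: "\<And>r. sublinear r \<Longrightarrow> r \<le> \<phi> \<Longrightarrow> r = \<phi>"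
    using exists_minimal_sublinear[OF p(1)] by blast
  \<comment> \<open>reducing with a singleton cannot lower a minimal functional, which makes it odd\<close>
  have odd: "\<phi> (- y) = - \<phi> y" for y
  proof -
    obtain r where r: "sublinear r" "r \<le> \<phi>" "r (- y) \<le> - \<phi> y"
      using sublinear_reduction[OF \<phi>(1), of "{y}" "\<phi> y"] by auto
    from min[OF r(1,2)] r(3) sublinear_ge_uminus[OF \<phi>(1), of "- y"] show ?thesis
      by simp
  qed
  have add: "\<phi> (x + y) = \<phi> x + \<phi> y" for x y
    using sublinear_add[OF \<phi>(1), of x y] sublinear_add[OF \<phi>(1), of "- x" "- y"]
      odd[of "x + y"] odd[of x] odd[of y] by simp
  have "\<phi> (c *\<^sub>R x) = c * \<phi> x" for c x
  proof (cases c "0::real" rule: linorder_cases)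
    case less
    then show ?thesis
      using sublinear_scaleR[OF \<phi>(1), of "- c" x] odd[of "c *\<^sub>R x"] by simp
  qed (simp_all add: sublinear_0[OF \<phi>(1)] sublinear_scaleR[OF \<phi>(1)])
  with add have "linear \<phi>"
    by (intro linearI) auto
  moreover have "\<phi> x \<le> q x" for x
    using \<phi>(2) p(2) by (meson le_fun_def order_trans)
  moreover have "\<beta> \<le> \<phi> d" if "d \<in> D" for d
  proof -
    have "\<phi> (- d) \<le> p (- d)" using \<phi>(2) by (simp add: le_fun_def)
    with p(3)[OF that] odd[of d] show ?thesis by simp
  qed
  ultimately show thesis by (rule that)
qed


section \<open>Gauges and continuous linear functionals\<close>

lemma tendsto_scaleR_lcs:
  fixes a :: "'a::locally_convex_space"
  assumes "(k \<longlongrightarrow> c) G" "(w \<longlongrightarrow> a) G"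
  shows "((\<lambda>z. k z *\<^sub>R w z) \<longlongrightarrow> c *\<^sub>R a) G"
  using filterlim_compose[OF tendsto_scaleR_nhds filterlim_Pair[OF assms]] by simp

text \<open>
  The Minkowski functional \<open>q x = inf {t > 0. x / t \<in> U}\<close>. It is finite because continuity of scalar
  multiplication at \<open>(0, x)\<close> makes \<open>U\<close> absorbing.
\<close>

lemma convex_nbhd_gauge:
  fixes U :: "'a::locally_convex_space set"
  assumes U: "open U" "convex U" "0 \<in> U"
  obtains q where "sublinear q" "\<And>x. q x < 1 \<Longrightarrow> x \<in> U" "\<And>x. x \<in> U \<Longrightarrow> q x \<le> 1"
proof -
  define S where "S x = {t. t > 0 \<and> inverse t *\<^sub>R x \<in> U}" for x
  define q where "q x = Inf (S x)" for x
  have bdd: "bdd_below (S x)" for x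
    by (rule bdd_belowI[of _ 0]) (auto simp: S_def)
  have ne: "S x \<noteq> {}" for x
  proof -
    have "((\<lambda>t. t *\<^sub>R x) \<longlongrightarrow> 0 *\<^sub>R x) (at_right 0)"
      by (intro tendsto_scaleR_lcs tendsto_const tendsto_ident_at)
    then have "\<forall>\<^sub>F t in at_right 0. t *\<^sub>R x \<in> U"
      by (rule topological_tendstoD) (use U in auto)
    moreover have "\<forall>\<^sub>F t in at_right 0. t > (0::real)"
      by (rule eventually_at_right_less)
    ultimately have "\<forall>\<^sub>F t in at_right 0. t > (0::real) \<and> t *\<^sub>R x \<in> U"
      by eventually_elim auto
    then obtain t where "t > (0::real)" "t *\<^sub>R x \<in> U"
      using eventually_happens' trivial_limit_at_right_real by blast
    then have "inverse t \<in> S x" by (simp add: S_def)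
    then show ?thesis by blast
  qed
  have q_le: "q x \<le> t" if "t > 0" "inverse t *\<^sub>R x \<in> U" for x t
    unfolding q_def using that by (intro cInf_lower bdd) (simp add: S_def)
  have q_ge: "c \<le> q x" if "\<And>t. t \<in> S x \<Longrightarrow> c \<le> t" for c x
    unfolding q_def using that by (intro cInf_greatest ne)
  have add2: "q (x + y) \<le> t + r" if t: "t \<in> S x" and r: "r \<in> S y" for x y t r
  proof (rule q_le)
    show pos: "t + r > 0" using t r by (simp add: S_def)
    have "(t / (t + r)) *\<^sub>R (inverse t *\<^sub>R x) + (r / (t + r)) *\<^sub>R (inverse r *\<^sub>R y) \<in> U"
      using t r pos by (intro convexD[OF U(2)]) (auto simp: S_def simp flip: add_divide_distrib)
    moreover have "(t / (t + r)) *\<^sub>R (inverse t *\<^sub>R x) + (r / (t + r)) *\<^sub>R (inverse r *\<^sub>R y)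
        = inverse (t + r) *\<^sub>R (x + y)"
      using t r pos by (simp add: S_def scaleR_add_right inverse_eq_divide)
    ultimately show "inverse (t + r) *\<^sub>R (x + y) \<in> U" by simp
  qed
  have "q (x + y) - t \<le> q y" if "t \<in> S x" for x y t
  proof (rule q_ge)
    fix r assume "r \<in> S y"
    from add2[OF that this] show "q (x + y) - t \<le> r" by simp
  qed
  then have "q (x + y) - q y \<le> q x" for x y
    by (intro q_ge) (simp add: algebra_simps)
  then have add: "q (x + y) \<le> q x + q y" for x y
    by (metis diff_le_eq)
  have "q (c *\<^sub>R x) / c \<le> q x" if c: "c > 0" for c x
  proof (rule q_ge)
    fix t assume t: "t \<in> S x"
    have "q (c *\<^sub>R x) \<le> c * t"
      using t c by (intro q_le) (auto simp: S_def field_simps)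
    then show "q (c *\<^sub>R x) / c \<le> t" using c by (simp add: field_simps)
  qed
  then have "sublinear q"
    using add by (simp add: sublinear_def pos_divide_le_eq mult.commute)
  moreover have "x \<in> U" if "q x < 1" for x
  proof -
    obtain t where t: "t \<in> S x" "t < 1"
      using cInf_lessD[OF ne[of x], of 1] \<open>q x < 1\<close> by (auto simp: q_def)
    have "t *\<^sub>R (inverse t *\<^sub>R x) + (1 - t) *\<^sub>R 0 \<in> U"
      using t U by (intro convexD[OF U(2)]) (auto simp: S_def)
    then show "x \<in> U" using t by (simp add: S_def)
  qed
  moreover have "q x \<le> 1" if "x \<in> U" for x
    using that by (intro q_le) auto
  ultimately show thesis by (rule that)
qed

lemma linear_bounded_above_imp_continuous:
  fixes \<phi> :: "'a::locally_convex_space \<Rightarrow> real"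
  assumes \<phi>: "linear \<phi>" and U: "open U" "0 \<in> U" and le: "\<And>x. x \<in> U \<Longrightarrow> \<phi> x \<le> 1"
  shows "continuous_on UNIV \<phi>"
  unfolding continuous_on_def
proof
  fix a :: 'a
  show "(\<phi> \<longlongrightarrow> \<phi> a) (at a within UNIV)"
  proof (rule tendstoI)
    fix e :: real assume e: "e > 0"
    have "((\<lambda>y. (2 / e) *\<^sub>R (y - a)) \<longlongrightarrow> (2 / e) *\<^sub>R (a - a)) (at a)"
      by (intro tendsto_scaleR_lcs tendsto_diff tendsto_const tendsto_ident_at)
    then have 1: "\<forall>\<^sub>F y in at a. (2 / e) *\<^sub>R (y - a) \<in> U"
      by (rule topological_tendstoD) (use U in auto)
    have "((\<lambda>y. (- 2 / e) *\<^sub>R (y - a)) \<longlongrightarrow> (- 2 / e) *\<^sub>R (a - a)) (at a)"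
      by (intro tendsto_scaleR_lcs tendsto_diff tendsto_const tendsto_ident_at)
    then have 2: "\<forall>\<^sub>F y in at a. (- 2 / e) *\<^sub>R (y - a) \<in> U"
      by (rule topological_tendstoD) (use U in auto)
    from 1 2 show "\<forall>\<^sub>F y in at a. dist (\<phi> y) (\<phi> a) < e"
    proof eventually_elim
      case (elim y)
      from le[OF elim(1)] le[OF elim(2)] have "\<phi> y - \<phi> a \<le> e / 2" "\<phi> a - \<phi> y \<le> e / 2"
        using e by (simp_all add: linear_cmul[OF \<phi>] linear_diff[OF \<phi>] field_simps)
      then have "\<bar>\<phi> y - \<phi> a\<bar> \<le> e / 2" by linarith
      then show ?case using e by (simp add: dist_real_def)
    qed
  qed
qed


section \<open>Functionals on the dual and on products with the reals\<close>

declare plus_dual.rep_eq [simp] zero_dual.rep_eq [simp] minus_dual.rep_eq [simp]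
  uminus_dual.rep_eq [simp] scaleR_dual.rep_eq [simp]

lemma linear_dual_apply: "linear (dual_apply u)"
  using dual_apply[of u] by simp

lemma linear_eval: "linear (\<lambda>u. dual_apply u x)"
  by (intro linearI) auto

lemma dual_apply_sum: "dual_apply (\<Sum>j\<in>J. u j) x = (\<Sum>j\<in>J. dual_apply (u j) x)"
  by (rule linear_sum[OF linear_eval])

lemma linear_prod_functional:
  fixes \<psi> :: "'v::real_vector \<times> real \<Rightarrow> real"
  assumes "linear \<psi>"
  shows "linear (\<lambda>y. \<psi> (y, 0))" "\<psi> (y, r) = \<psi> (y, 0) + \<psi> (0, 1) * r"
proof -
  show "linear (\<lambda>y. \<psi> (y, 0))"
    using linear_add[OF assms, of "(_, 0)" "(_, 0)"] linear_cmul[OF assms, of _ "(_, 0)"]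
    by (intro linearI) auto
  show "\<psi> (y, r) = \<psi> (y, 0) + \<psi> (0, 1) * r"
    using linear_add[OF assms, of "(y, 0)" "(0, r)"] linear_cmul[OF assms, of r "(0, 1)"] by simp
qed


section \<open>Separating hyperplanes that are not vertical\<close>

text \<open>
  A separating hyperplane of a set \<open>E\<close> in \<open>Z \<times> \<real>\<close> may be vertical (\<open>b = 0\<close>) and then says nothing about
  the real coordinate. Adding a large multiple \<open>n\<close> of it to a minorant \<open>m z + r \<ge> c\<close> produces the
  functional \<open>m + n a\<close> with coefficient \<open>1 + n b > 0\<close> in the real coordinate; it still separates since
  the gap grows like \<open>n\<close>. Dividing by \<open>1 + n b\<close> normalises that coefficient to \<open>1\<close>. The conclusion
  displays the new functional as a combination of \<open>m\<close> and \<open>a\<close>, so that it stays in any subspace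
  containing both: the continuous functionals on \<open>X\<close> for the Fenchel-Moreau theorem, the evaluations at points
  of \<open>X\<close> for the weak* separation in \<open>X\<^sup>* \<times> \<real>\<close>.
\<close>

lemma nonvertical_separation:
  fixes a m :: "'z::real_vector \<Rightarrow> real"
  assumes a: "linear a" "b \<ge> 0"
    and sep: "\<And>z r. (z, r) \<in> E \<Longrightarrow> 1 \<le> a (z - z0) + b * (r - r0)"
    and minorant: "\<And>z r. (z, r) \<in> E \<Longrightarrow> c \<le> m z + r"
  obtains \<alpha> \<beta> \<eta> where "\<eta> > 0"
    "\<And>z r. (z, r) \<in> E \<Longrightarrow> \<alpha> * m z0 + \<beta> * a z0 + r0 + \<eta> \<le> \<alpha> * m z + \<beta> * a z + r"
proof -
  define n where "n = max 0 (m z0 + r0 - c + 1)"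
  have n: "n \<ge> 0" "c + n \<ge> m z0 + r0 + 1" by (auto simp: n_def)
  define M where "M = 1 + n * b"
  have M: "M > 0" using n a(2) by (simp add: M_def add_pos_nonneg)
  show thesis
  proof (rule that[of "1 / M" "1 / M" "n / M"])
    show "1 / M > 0" using M by simp
    fix z r assume zr: "(z, r) \<in> E"
    have "n * 1 \<le> n * (a (z - z0) + b * (r - r0))"
      by (rule mult_left_mono[OF sep[OF zr] n(1)])
    then have "m z0 + n * a z0 + M * r0 + 1 \<le> m z + n * a z + M * r"
      using minorant[OF zr] n by (simp add: M_def linear_diff[OF a(1)] algebra_simps)
    then have "(m z0 + n * a z0 + M * r0 + 1) / M \<le> (m z + n * a z + M * r) / M"
      using M by (simp add: divide_right_mono)
    then show "1 / M * m z0 + n / M * a z0 + r0 + 1 / M \<le> 1 / M * m z + n / M * a z + r"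
      using M by (simp add: add_divide_distrib)
  qed
qed


section \<open>Fenchel-Moreau duality\<close>

text \<open>
  With epigraphs on both sides, membership amounts to one inequality between real numbers for each
  point \<open>(x, t)\<close> of the epigraph of \<open>h\<close>; \<open>fenchel_moreau\<close> below is the mirror image.
\<close>

lemma epi_conjugate_iff:
  "(u, r) \<in> epi (conjugate h) \<longleftrightarrow> (\<forall>x t. h x \<le> ereal t \<longrightarrow> dual_apply u x \<le> t + r)"
proof -
  have "ereal d - y \<le> ereal r \<longleftrightarrow> (\<forall>t. y \<le> ereal t \<longrightarrow> d \<le> t + r)" for d and y :: ereal
  proof (cases y)
    case (real z)
    then show ?thesis by (auto simp: diff_le_eq)
  next
    case MInf
    have "\<not> d \<le> (d - r - 1) + r" by simp
    then have "\<not> (\<forall>t. d \<le> t + r)" by blast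
    then show ?thesis using MInf by simp
  qed auto
  then show ?thesis
    by (simp add: epi_def conjugate_def SUP_le_iff)
qed

lemma convex_epi:
  assumes "convex_fun h" "\<And>x. h x \<noteq> -\<infinity>"
  shows "convex (epi h)"
  unfolding convex_alt
proof (intro ballI allI impI)
  fix p q :: "'a \<times> real" and t :: real
  assume p: "p \<in> epi h" and q: "q \<in> epi h" and t: "0 \<le> t \<and> t \<le> 1"
  show "(1 - t) *\<^sub>R p + t *\<^sub>R q \<in> epi h"
  proof (cases "t = 0 \<or> t = 1")
    case False
    then have t: "0 < t" "t < 1" using t by auto
    obtain x r y s where xy: "p = (x, r)" "q = (y, s)" by fastforce
    have "h ((1 - t) *\<^sub>R x + t *\<^sub>R y) \<le> ereal (1 - t) * h x + ereal t * h y"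
      using assms(1) t by (simp add: convex_fun_def)
    also have "\<dots> \<le> ereal (1 - t) * ereal r + ereal t * ereal s"
      using p q t xy by (intro add_mono ereal_mult_left_mono) (auto simp: epi_def)
    finally show ?thesis by (simp add: xy epi_def)
  qed (use p q in auto)
qed

lemma Gamma_funD:
  assumes "h \<in> Gamma_fun"
  shows "h x \<noteq> -\<infinity>" "convex (epi h)" "epi h \<noteq> {}" "r < h x \<Longrightarrow> \<forall>\<^sub>F y in nhds x. r < h y"
proof -
  show ninf: "h x \<noteq> -\<infinity>" for x
    using assms by (auto simp: Gamma_fun_def proper_fun_def)
  then show "convex (epi h)"
    using assms by (intro convex_epi) (auto simp: Gamma_fun_def)
  obtain z where "h z \<noteq> \<infinity>"
    using assms by (auto simp: Gamma_fun_def proper_fun_def)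
  with ninf[of z] have "(z, real_of_ereal (h z)) \<in> epi h"
    by (cases "h z") (auto simp: epi_def)
  then show "epi h \<noteq> {}" by blast
  show "r < h x \<Longrightarrow> \<forall>\<^sub>F y in nhds x. r < h y"
    using assms by (auto simp: Gamma_fun_def lower_semicontinuous_def)
qed

text \<open>
  Lower semicontinuity gives a convex neighbourhood \<open>x0 + U\<close> on which \<open>h > t + \<delta>\<close>. With \<open>q\<close> the gauge of
  \<open>U\<close>, the sublinear functional \<open>Q (y, r) = max (q y) (r / \<delta>)\<close> is at least \<open>1\<close> on the epigraph
  translated by \<open>- (x0, t)\<close>: a point over \<open>x0 + U\<close> lies more than \<open>\<delta>\<close> too high, and any other point
  is too far away. The Mazur-Orlicz functional below \<open>Q\<close> is the required hyperplane.
\<close>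

lemma epi_separation:
  fixes h :: "'a::locally_convex_space \<Rightarrow> ereal"
  assumes h: "h \<in> Gamma_fun" and t: "ereal t < h x0"
  obtains a b where "b \<ge> 0"
    "\<And>x r. (x, r) \<in> epi h \<Longrightarrow> 1 \<le> dual_apply a (x - x0) + b * (r - t)"
proof -
  obtain t1 where t1: "ereal t < ereal t1" "ereal t1 < h x0"
    using ereal_dense2[OF t] by blast
  define \<delta> where "\<delta> = t1 - t"
  have \<delta>: "\<delta> > 0" using t1 by (simp add: \<delta>_def)
  obtain W where W: "open W" "x0 \<in> W" "\<And>y. y \<in> W \<Longrightarrow> ereal t1 < h y"
    using Gamma_funD(4)[OF h t1(2)] unfolding eventually_nhds by blast
  obtain V where V: "open V" "convex V" "x0 \<in> V" "V \<subseteq> W"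
    using locally_convex[OF W(1,2)] by blast
  define U where "U = (\<lambda>y. x0 + y) -` V"
  have "open U"
    unfolding U_def by (intro open_vimage V continuous_intros)
  moreover have "convex U"
  proof (rule convexI)
    fix x y and u v :: real
    assume *: "x \<in> U" "y \<in> U" "0 \<le> u" "0 \<le> v" "u + v = 1"
    then have "u *\<^sub>R (x0 + x) + v *\<^sub>R (x0 + y) \<in> V"
      by (intro convexD[OF V(2)]) (auto simp: U_def)
    also have "u *\<^sub>R (x0 + x) + v *\<^sub>R (x0 + y) = (u + v) *\<^sub>R x0 + (u *\<^sub>R x + v *\<^sub>R y)"
      by (simp add: algebra_simps)
    finally show "u *\<^sub>R x + v *\<^sub>R y \<in> U" using * by (simp add: U_def)
  qed
  moreover have "0 \<in> U" using V by (simp add: U_def)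
  ultimately obtain q where q: "sublinear q" "\<And>x. q x < 1 \<Longrightarrow> x \<in> U" "\<And>x. x \<in> U \<Longrightarrow> q x \<le> 1"
    using convex_nbhd_gauge by blast
  define Q where "Q = (\<lambda>(y, r). max (q y) (r / \<delta>))"
  have Q: "sublinear Q"
    unfolding sublinear_def
  proof (intro conjI allI impI)
    fix p p' :: "'a \<times> real"
    show "Q (p + p') \<le> Q p + Q p'"
      using sublinear_add[OF q(1), of "fst p" "fst p'"]
      by (auto simp: Q_def split_beta add_divide_distrib max_def)
  next
    fix p :: "'a \<times> real" and s :: real assume "s > 0"
    then show "Q (s *\<^sub>R p) \<le> s * Q p"
      using sublinear_scaleR[OF q(1)]
      by (auto simp: Q_def split_beta max_mult_distrib_left)
  qed
  define D where "D = (\<lambda>p. - (x0, t) + p) ` epi h"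
  have D: "convex D" "D \<noteq> {}"
    using Gamma_funD(2,3)[OF h] by (auto simp: D_def intro!: convex_translation)
  have "1 \<le> Q d" if dD: "d \<in> D" for d
  proof -
    obtain x r where "d = - (x0, t) + (x, r)" and xr: "h x \<le> ereal r"
      using dD by (auto simp: D_def epi_def)
    then have d: "d = (x - x0, r - t)" by simp
    show ?thesis
    proof (cases "x - x0 \<in> U")
      case True
      then have "x \<in> W" using V by (auto simp: U_def)
      then have "ereal t1 < ereal r" using W(3) xr by (meson order_less_le_trans)
      then show ?thesis using \<delta> by (simp add: Q_def d \<delta>_def le_max_iff_disj)
    next
      case False
      then have "1 \<le> q (x - x0)" using q(2) by (meson not_less)
      then show ?thesis by (simp add: Q_def d)
    qed
  qed
  then obtain \<psi> where \<psi>: "linear \<psi>" "\<And>p. \<psi> p \<le> Q p" "\<And>d. d \<in> D \<Longrightarrow> 1 \<le> \<psi> d"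
    using mazur_orlicz[OF Q D] by blast
  define \<phi> where "\<phi> y = \<psi> (y, 0)" for y
  have \<phi>: "linear \<phi>" unfolding \<phi>_def by (rule linear_prod_functional[OF \<psi>(1)])
  have "\<phi> y \<le> 1" if "y \<in> U" for y
    using \<psi>(2)[of "(y, 0)"] q(3)[OF that] by (auto simp: \<phi>_def Q_def max_def split: if_splits)
  then have "continuous_on UNIV \<phi>"
    using linear_bounded_above_imp_continuous[OF \<phi> \<open>open U\<close> \<open>0 \<in> U\<close>] by blast
  then have dual: "dual_apply (Abs_dual \<phi>) = \<phi>"
    using \<phi> by (simp add: Abs_dual_inverse)
  show thesis
  proof (rule that)
    show "\<psi> (0, 1) \<ge> 0"
      using \<psi>(2)[of "(0, - 1)"] linear_prod_functional(2)[OF \<psi>(1), of 0 "- 1"] \<delta>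
        sublinear_0[OF q(1)] linear_0[OF \<phi>] by (simp add: Q_def \<phi>_def)
    fix x r assume "(x, r) \<in> epi h"
    then have "(x - x0, r - t) \<in> D"
      unfolding D_def by (intro image_eqI[of _ _ "(x, r)"]) auto
    from \<psi>(3)[OF this]
    show "1 \<le> dual_apply (Abs_dual \<phi>) (x - x0) + \<psi> (0, 1) * (r - t)"
      by (simp add: dual \<phi>_def linear_prod_functional(2)[OF \<psi>(1), of "x - x0" "r - t"])
  qed
qed

text \<open>
  Separate \<open>(x0, h x0 - 1)\<close> from the epigraph, for some \<open>x0\<close> in the domain. The hyperplane is not
  vertical: with \<open>b = 0\<close> the separating inequality at the point \<open>(x0, h x0)\<close> would read \<open>1 \<le> 0\<close>.
\<close>

lemma Gamma_fun_affine_minorant: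
  assumes h: "h \<in> Gamma_fun"
  obtains u r where "(u, r) \<in> epi (conjugate h)"
proof -
  obtain x0 r0 where x0: "h x0 \<le> ereal r0"
    using Gamma_funD(3)[OF h] by (auto simp: epi_def)
  then obtain c where c: "h x0 = ereal c"
    using Gamma_funD(1)[OF h, of x0] by (cases "h x0") auto
  have "ereal (c - 1) < h x0" by (simp add: c)
  then obtain a b where "b \<ge> 0"
    and sep: "\<And>x r. (x, r) \<in> epi h \<Longrightarrow> 1 \<le> dual_apply a (x - x0) + b * (r - (c - 1))"
    by (rule epi_separation[OF h]) (rule that)
  from sep[of x0 c] have "b \<ge> 1"
    by (simp add: epi_def c linear_0[OF linear_dual_apply])
  have "(- (1 / b) *\<^sub>R a, - dual_apply a x0 / b - (c - 1)) \<in> epi (conjugate h)"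
    unfolding epi_conjugate_iff
  proof (intro allI impI)
    fix x t assume "h x \<le> ereal t"
    then have "0 \<le> dual_apply a (x - x0) + b * (t - (c - 1))"
      using sep[of x t] by (simp add: epi_def)
    then have "0 \<le> (dual_apply a (x - x0) + b * (t - (c - 1))) / b"
      using \<open>b \<ge> 1\<close> by simp
    then show "dual_apply (- (1 / b) *\<^sub>R a) x \<le> t + (- dual_apply a x0 / b - (c - 1))"
      using \<open>b \<ge> 1\<close> by (simp add: linear_diff[OF linear_dual_apply] add_divide_distrib diff_divide_distrib)
  qed
  then show thesis by (rule that)
qed

text \<open>
  If \<open>t < h x0\<close>, the hyperplane separating \<open>(x0, t)\<close> from the epigraph can be made non-vertical with
  the help of an affine minorant. It is then the graph of an affine minorant of \<open>h\<close> that exceeds \<open>t\<close>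
  at \<open>x0\<close>, and its slope violates the hypothesis.
\<close>

theorem fenchel_moreau:
  assumes h: "h \<in> Gamma_fun"
    and le: "\<And>u r. (u, r) \<in> epi (conjugate h) \<Longrightarrow> dual_apply u x0 \<le> t + r"
  shows "h x0 \<le> ereal t"
proof (rule ccontr)
  assume "\<not> ?thesis"
  then have t: "ereal t < h x0" by simp
  obtain a b where b: "b \<ge> 0"
    and sep: "\<And>x r. (x, r) \<in> epi h \<Longrightarrow> 1 \<le> dual_apply a (x - x0) + b * (r - t)"
    by (rule epi_separation[OF h t]) (rule that)
  obtain v c where vc: "(v, c) \<in> epi (conjugate h)"
    using Gamma_fun_affine_minorant[OF h] by blast
  have minor: "- c \<le> dual_apply (- v) x + r" if "(x, r) \<in> epi h" for x r
    using vc[unfolded epi_conjugate_iff, rule_format, of x r] that by (simp add: epi_def)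
  obtain \<alpha> \<beta> \<eta> where \<eta>: "\<eta> > 0"
    and *: "\<And>x r. (x, r) \<in> epi h \<Longrightarrow>
      \<alpha> * dual_apply (- v) x0 + \<beta> * dual_apply a x0 + t + \<eta>
        \<le> \<alpha> * dual_apply (- v) x + \<beta> * dual_apply a x + r"
    by (rule nonvertical_separation[where E = "epi h" and m = "dual_apply (- v)", OF linear_dual_apply b])
      (use sep minor that in blast)+
  define u where "u = \<alpha> *\<^sub>R v - \<beta> *\<^sub>R a"
  have "(u, dual_apply u x0 - t - \<eta>) \<in> epi (conjugate h)"
    unfolding epi_conjugate_iff
  proof (intro allI impI)
    fix x r assume "h x \<le> ereal r"
    then show "dual_apply u x \<le> r + (dual_apply u x0 - t - \<eta>)"
      using *[of x r] by (simp add: epi_def u_def)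
  qed
  from le[OF this] \<eta> show False by simp
qed


section \<open>Separation in the weak* topology\<close>

lemma weak_star_nbhd:
  fixes U :: "'a::locally_convex_space dual set"
  assumes "open U" "u \<in> U"
  shows "\<exists>F e. finite F \<and> e > 0 \<and>
    (\<forall>v. (\<forall>x\<in>F. \<bar>dual_apply (v - u) x\<bar> < e) \<longrightarrow> v \<in> U)"
  using assms(1)[unfolded open_dual_def] assms(2)
proof (induction arbitrary: u)
  case UNIV
  show ?case by (intro exI[of _ "{}"] exI[of _ 1]) auto
next
  case (Int U V)
  obtain F e where F: "finite F" "e > 0" "\<And>v. (\<forall>x\<in>F. \<bar>dual_apply (v - u) x\<bar> < e) \<Longrightarrow> v \<in> U"
    using Int.IH(1)[of u] Int.prems by blast
  obtain G d where G: "finite G" "d > 0" "\<And>v. (\<forall>x\<in>G. \<bar>dual_apply (v - u) x\<bar> < d) \<Longrightarrow> v \<in> V"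
    using Int.IH(2)[of u] Int.prems by blast
  show ?case
    using F G by (intro exI[of _ "F \<union> G"] exI[of _ "min e d"]) auto
next
  case (UN K)
  then obtain U where U: "U \<in> K" "u \<in> U" by blast
  from UN.IH[OF this] show ?case using U by (meson UnionI)
next
  case (Basis U)
  then obtain x V where V: "open V" "U = (\<lambda>u. dual_apply u x) -` V" by blast
  with Basis(2) obtain e where e: "e > 0" "\<And>y. dist y (dual_apply u x) < e \<Longrightarrow> y \<in> V"
    unfolding open_dist by fastforce
  then show ?case
    using V by (intro exI[of _ "{x}"] exI[of _ e]) (auto simp: dist_real_def)
qed

text \<open>
  The algebraic reason why the dual of \<open>X\<^sup>*\<close> with the weak* topology is \<open>X\<close>: a functional controlled by
  finitely many evaluations vanishes on their common kernel, hence is a combination of them.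
\<close>

lemma linear_combination_if_kernels:
  fixes \<phi> :: "'v::real_vector \<Rightarrow> real" and \<Phi> :: "'i \<Rightarrow> 'v \<Rightarrow> real"
  assumes "finite F" "linear \<phi>" "\<And>i. linear (\<Phi> i)"
    and "\<And>v. (\<And>i. i \<in> F \<Longrightarrow> \<Phi> i v = 0) \<Longrightarrow> \<phi> v = 0"
  shows "\<exists>c. \<forall>v. \<phi> v = (\<Sum>i\<in>F. c i * \<Phi> i v)"
  using assms
proof (induction F arbitrary: \<phi> rule: finite_induct)
  case empty
  then show ?case by simp
next
  case (insert k F)
  show ?case
  proof (cases "\<forall>v. (\<forall>i\<in>F. \<Phi> i v = 0) \<longrightarrow> \<Phi> k v = 0")
    case True
    then have "\<exists>c. \<forall>v. \<phi> v = (\<Sum>i\<in>F. c i * \<Phi> i v)"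
      using insert.prems by (intro insert.IH) auto
    then obtain c where c: "\<And>v. \<phi> v = (\<Sum>i\<in>F. c i * \<Phi> i v)" by blast
    have "(\<Sum>i\<in>F. (c(k := 0)) i * \<Phi> i v) = (\<Sum>i\<in>F. c i * \<Phi> i v)" for v
      using insert.hyps by (intro sum.cong) auto
    then show ?thesis
      using c insert.hyps by (intro exI[of _ "c(k := 0)"]) simp
  next
    case False
    then obtain w where w: "\<And>i. i \<in> F \<Longrightarrow> \<Phi> i w = 0" "\<Phi> k w \<noteq> 0" by blast
    define a where "a = \<phi> w / \<Phi> k w"
    have "\<exists>c. \<forall>v. \<phi> v - a * \<Phi> k v = (\<Sum>i\<in>F. c i * \<Phi> i v)"
    proof (rule insert.IH)
      show "linear (\<lambda>v. \<phi> v - a * \<Phi> k v)"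
        using insert.prems
        by (intro linearI) (auto simp: linear_add linear_cmul algebra_simps)
      fix v assume v: "\<And>i. i \<in> F \<Longrightarrow> \<Phi> i v = 0"
      \<comment> \<open>subtracting a multiple of \<open>w\<close> moves \<open>v\<close> into the kernel of \<open>\<Phi> k\<close> as well\<close>
      have "\<phi> (v - (\<Phi> k v / \<Phi> k w) *\<^sub>R w) = 0"
        using v w insert.prems(2) by (intro insert.prems(3)) (auto simp: linear_diff linear_cmul)
      then show "\<phi> v - a * \<Phi> k v = 0"
        using insert.prems(1) by (simp add: linear_diff linear_cmul a_def)
    qed (use insert.prems in auto)
    then obtain c where c: "\<And>v. \<phi> v = a * \<Phi> k v + (\<Sum>i\<in>F. c i * \<Phi> i v)"
      by (metis add.commute diff_add_cancel)
    have "(\<Sum>i\<in>F. (c(k := a)) i * \<Phi> i v) = (\<Sum>i\<in>F. c i * \<Phi> i v)" for v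
      using insert.hyps by (intro sum.cong) auto
    then show ?thesis
      using c insert.hyps by (intro exI[of _ "c(k := a)"]) simp
  qed
qed

text \<open>
  A weak* neighbourhood of \<open>(u0, r0)\<close> that misses \<open>E\<close> is controlled by finitely many evaluations and the real
  coordinate. The sum of their absolute values, scaled by \<open>1 / e\<close>, is sublinear and at least \<open>1\<close> on
  \<open>E - (u0, r0)\<close>. A linear functional below it vanishes on the common kernel of these evaluations, so
  it is itself an evaluation at some \<open>y \<in> X\<close>, plus a multiple of the real coordinate.
\<close>

lemma weak_star_separation:
  fixes E :: "('a::locally_convex_space dual \<times> real) set"
  assumes E: "closed E" "convex E" "E \<noteq> {}" and notin: "(u0, r0) \<notin> E"
  obtains y b where "\<And>u r. (u, r) \<in> E \<Longrightarrow> 1 \<le> dual_apply (u - u0) y + b * (r - r0)"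
proof -
  have "open (- E)" "(u0, r0) \<in> - E" using E notin by auto
  then obtain A B where AB: "open A" "open B" "u0 \<in> A" "r0 \<in> B" "A \<times> B \<subseteq> - E"
    by (elim open_prod_elim) auto
  obtain F e1 where F: "finite F" "e1 > 0"
    "\<And>v. (\<forall>x\<in>F. \<bar>dual_apply (v - u0) x\<bar> < e1) \<Longrightarrow> v \<in> A"
    using weak_star_nbhd[OF AB(1,3)] by blast
  obtain e2 where e2: "e2 > 0" "\<And>r. dist r r0 < e2 \<Longrightarrow> r \<in> B"
    using AB(2,4) unfolding open_dist by blast
  define e where "e = min e1 e2"
  have e: "e > 0" using F e2 by (simp add: e_def)
  define Q where "Q = (\<lambda>(u, r). ((\<Sum>x\<in>F. \<bar>dual_apply u x\<bar>) + \<bar>r\<bar>) / e)"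
  have Q: "sublinear Q"
    unfolding sublinear_def
  proof (intro conjI allI impI)
    fix p p' :: "'a dual \<times> real"
    have "(\<Sum>x\<in>F. \<bar>dual_apply (fst p) x + dual_apply (fst p') x\<bar>)
        \<le> (\<Sum>x\<in>F. \<bar>dual_apply (fst p) x\<bar> + \<bar>dual_apply (fst p') x\<bar>)"
      by (intro sum_mono abs_triangle_ineq)
    then have "(\<Sum>x\<in>F. \<bar>dual_apply (fst p) x + dual_apply (fst p') x\<bar>) + \<bar>snd p + snd p'\<bar>
        \<le> ((\<Sum>x\<in>F. \<bar>dual_apply (fst p) x\<bar>) + \<bar>snd p\<bar>)
          + ((\<Sum>x\<in>F. \<bar>dual_apply (fst p') x\<bar>) + \<bar>snd p'\<bar>)"
      unfolding sum.distrib using abs_triangle_ineq[of "snd p" "snd p'"] by linarith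
    then show "Q (p + p') \<le> Q p + Q p'"
      using e by (simp add: Q_def split_beta divide_right_mono flip: add_divide_distrib)
  next
    fix p :: "'a dual \<times> real" and s :: real assume "s > 0"
    then show "Q (s *\<^sub>R p) \<le> s * Q p"
      by (simp add: Q_def split_beta abs_mult distrib_left flip: sum_distrib_left)
  qed
  define D where "D = (\<lambda>p. - (u0, r0) + p) ` E"
  have D: "convex D" "D \<noteq> {}"
    using E by (auto simp: D_def intro!: convex_translation)
  have "1 \<le> Q d" if dD: "d \<in> D" for d
  proof -
    obtain u r where "d = - (u0, r0) + (u, r)" and ur: "(u, r) \<in> E"
      using dD by (auto simp: D_def)
    then have d: "d = (u - u0, r - r0)" by simp
    show ?thesis
    proof (rule ccontr)
      assume "\<not> 1 \<le> Q d"
      then have less: "(\<Sum>x\<in>F. \<bar>dual_apply (u - u0) x\<bar>) + \<bar>r - r0\<bar> < e"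
        using e by (simp add: Q_def d)
      have "\<bar>dual_apply (u - u0) x\<bar> \<le> (\<Sum>x\<in>F. \<bar>dual_apply (u - u0) x\<bar>)" if "x \<in> F" for x
        using that F(1) by (intro member_le_sum) auto
      then have "\<forall>x\<in>F. \<bar>dual_apply (u - u0) x\<bar> < e1"
        using less by (force simp: e_def)
      then have "u \<in> A" by (rule F(3))
      moreover have "(\<Sum>x\<in>F. \<bar>dual_apply (u - u0) x\<bar>) \<ge> 0"
        by (intro sum_nonneg) auto
      then have "\<bar>r - r0\<bar> < e2"
        using less unfolding e_def by linarith
      then have "r \<in> B"
        by (intro e2(2)) (simp add: dist_real_def)
      ultimately show False using AB(5) ur by blast
    qed
  qed
  then obtain \<psi> where \<psi>: "linear \<psi>" "\<And>p. \<psi> p \<le> Q p" "\<And>d. d \<in> D \<Longrightarrow> 1 \<le> \<psi> d"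
    using mazur_orlicz[OF Q D] by blast
  have lin: "linear (\<lambda>u. \<psi> (u, 0))" by (rule linear_prod_functional[OF \<psi>(1)])
  have "\<psi> (u, 0) = 0" if "\<And>x. x \<in> F \<Longrightarrow> dual_apply u x = 0" for u
    using \<psi>(2)[of "(u, 0)"] \<psi>(2)[of "(- u, 0)"] that linear_neg[OF lin, of u]
    by (simp add: Q_def)
  then obtain c where c: "\<And>u. \<psi> (u, 0) = (\<Sum>x\<in>F. c x * dual_apply u x)"
    using linear_combination_if_kernels[OF F(1) lin, of "\<lambda>x u. dual_apply u x"] linear_eval
    by blast
  show thesis
  proof (rule that)
    fix u r assume "(u, r) \<in> E"
    then have "(u - u0, r - r0) \<in> D"
      unfolding D_def by (intro image_eqI[of _ _ "(u, r)"]) auto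
    from \<psi>(3)[OF this]
    show "1 \<le> dual_apply (u - u0) (\<Sum>x\<in>F. c x *\<^sub>R x) + \<psi> (0, 1) * (r - r0)"
      by (simp add: linear_sum[OF linear_dual_apply] linear_cmul[OF linear_dual_apply] c
          right_diff_distrib sum_subtractf
          linear_prod_functional(2)[OF \<psi>(1), of "u - u0" "r - r0"])
  qed
qed


section \<open>The characteristic cone\<close>

text \<open>
  For convex sets one multiple per set suffices, because the conic hull of a convex set is already a
  convex cone and thus absorbs sums of several multiples.
\<close>

lemma convex_cone_hull_UN_convex:
  fixes S :: "'i \<Rightarrow> 'v::real_vector set"
  assumes S: "\<And>i. i \<in> I \<Longrightarrow> convex (S i)" "\<And>i. i \<in> I \<Longrightarrow> S i \<noteq> {}"
    and p: "p \<in> convex_cone hull (\<Union>i\<in>I. S i)"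
  obtains J l q where "finite J" "J \<subseteq> I" "\<And>j. j \<in> J \<Longrightarrow> l j \<ge> 0" "\<And>j. j \<in> J \<Longrightarrow> q j \<in> S j"
    "p = (\<Sum>j\<in>J. l j *\<^sub>R q j)"
proof -
  define N where "N i = conic hull (S i)" for i
  have N: "convex_cone (N i)" if "i \<in> I" for i
    using S that unfolding N_def convex_cone_def
    by (simp add: convex_conic_hull conic_conic_hull conic_hull_eq_empty)
  \<comment> \<open>letting \<open>k\<close> vanish off \<open>J\<close> allows two such sums to be extended to a common index set and added there\<close>
  define T where "T = {(\<Sum>j\<in>J. k j) | J k. finite J \<and> J \<subseteq> I \<and> (\<forall>i\<in>I. k i \<in> N i) \<and> (\<forall>i. i \<notin> J \<longrightarrow> k i = 0)}"
  have T_I: "(\<Sum>j\<in>J. k j) \<in> T"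
    if "finite J" "J \<subseteq> I" "\<And>i. i \<in> I \<Longrightarrow> k i \<in> N i" "\<And>i. i \<notin> J \<Longrightarrow> k i = 0" for J k
    using that unfolding T_def by blast
  have T_E: "\<exists>J k. finite J \<and> J \<subseteq> I \<and> (\<forall>i\<in>I. k i \<in> N i) \<and> (\<forall>i. i \<notin> J \<longrightarrow> k i = 0) \<and> p = (\<Sum>j\<in>J. k j)"
    if "p \<in> T" for p
    using that unfolding T_def by blast
  have "convex_cone T"
    unfolding convex_cone_iff
  proof (intro conjI ballI allI impI)
    show "0 \<in> T"
      using T_I[of "{}" "\<lambda>_. 0"] N by (simp add: convex_cone_contains_0)
  next
    fix x y assume xy: "x \<in> T" "y \<in> T"
    obtain J k where J: "finite J" "J \<subseteq> I" "\<forall>i\<in>I. k i \<in> N i" "\<forall>i. i \<notin> J \<longrightarrow> k i = 0" "x = (\<Sum>j\<in>J. k j)"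
      using T_E[OF xy(1)] by blast
    obtain J' k' where J': "finite J'" "J' \<subseteq> I" "\<forall>i\<in>I. k' i \<in> N i" "\<forall>i. i \<notin> J' \<longrightarrow> k' i = 0" "y = (\<Sum>j\<in>J'. k' j)"
      using T_E[OF xy(2)] by blast
    have "x = (\<Sum>j\<in>J \<union> J'. k j)" "y = (\<Sum>j\<in>J \<union> J'. k' j)"
      using J J' by (auto intro!: sum.mono_neutral_left)
    then have "x + y = (\<Sum>j\<in>J \<union> J'. k j + k' j)"
      by (simp add: sum.distrib)
    also have "\<dots> \<in> T"
      using J J' N by (intro T_I) (auto intro: convex_cone_add)
    finally show "x + y \<in> T" .
  next
    fix x and c :: real assume x: "x \<in> T" and c: "0 \<le> c"
    obtain J k where J: "finite J" "J \<subseteq> I" "\<forall>i\<in>I. k i \<in> N i" "\<forall>i. i \<notin> J \<longrightarrow> k i = 0" "x = (\<Sum>j\<in>J. k j)"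
      using T_E[OF x] by blast
    have "c *\<^sub>R x = (\<Sum>j\<in>J. c *\<^sub>R k j)"
      by (simp add: J scaleR_sum_right)
    also have "\<dots> \<in> T"
      using J N c by (intro T_I) (auto intro: convex_cone_scaleR)
    finally show "c *\<^sub>R x \<in> T" .
  qed
  moreover have "(\<Union>i\<in>I. S i) \<subseteq> T"
  proof clarify
    fix i x assume ix: "i \<in> I" "x \<in> S i"
    then have "x \<in> N i" unfolding N_def by (simp add: hull_inc)
    then show "x \<in> T"
      using T_I[of "{i}" "\<lambda>j. if j = i then x else 0"] ix N by (auto simp: convex_cone_contains_0)
  qed
  ultimately have "convex_cone hull (\<Union>i\<in>I. S i) \<subseteq> T"
    by (intro hull_minimal)
  with p have "p \<in> T" by blast
  then obtain J k where J: "finite J" "J \<subseteq> I" "\<forall>i\<in>I. k i \<in> N i" "p = (\<Sum>j\<in>J. k j)"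
    using T_E by blast
  then have "\<forall>j\<in>J. \<exists>c x. 0 \<le> c \<and> x \<in> S j \<and> k j = c *\<^sub>R x"
    by (fastforce simp: N_def conic_hull_explicit)
  then obtain l q where "\<forall>j\<in>J. 0 \<le> l j \<and> q j \<in> S j \<and> k j = l j *\<^sub>R q j"
    by metis
  with J show thesis by (intro that[of J l q]) auto
qed

lemma convex_epi_conjugate: "convex (epi (conjugate h))"
proof (rule convexI)
  fix p q :: "'a dual \<times> real" and a b :: real
  assume *: "p \<in> epi (conjugate h)" "q \<in> epi (conjugate h)" "0 \<le> a" "0 \<le> b" "a + b = 1"
  obtain u r v s where pq: "p = (u, r)" "q = (v, s)" by fastforce
  show "a *\<^sub>R p + b *\<^sub>R q \<in> epi (conjugate h)"
    unfolding pq scaleR_Pair add_Pair epi_conjugate_iff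
  proof (intro allI impI)
    fix x t assume "h x \<le> ereal t"
    then have "dual_apply u x \<le> t + r" "dual_apply v x \<le> t + s"
      using * pq by (auto simp: epi_conjugate_iff)
    then have "a * dual_apply u x + b * dual_apply v x \<le> a * (t + r) + b * (t + s)"
      using * by (intro add_mono mult_left_mono)
    also have "\<dots> = (a + b) * t + (a * r + b * s)" by (simp add: algebra_simps)
    finally show "dual_apply (a *\<^sub>R u + b *\<^sub>R v) x \<le> t + (a *\<^sub>R r + b *\<^sub>R s)"
      using * by simp
  qed
qed

lemma epi_support_iff:
  "(v, a) \<in> epi (conjugate (indicator_fun C)) \<longleftrightarrow> (\<forall>x\<in>C. dual_apply v x \<le> a)"
proof -
  have "indicator_fun C x \<le> ereal t \<longleftrightarrow> x \<in> C \<and> 0 \<le> t" for x t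
    by (simp add: indicator_fun_def zero_ereal_def)
  then show ?thesis
    unfolding epi_conjugate_iff by (metis add_0 add_increasing order_refl)
qed

lemma convex_cone_epi_support: "convex_cone (epi (conjugate (indicator_fun C)))"
  unfolding convex_cone_iff
  by (auto simp: epi_support_iff zero_prod_def add_mono mult_left_mono)

lemma indicator_fun_in_Gamma_fun:
  fixes C :: "'a::locally_convex_space set"
  assumes "C \<noteq> {}" "closed C" "convex C"
  shows "indicator_fun C \<in> Gamma_fun"
proof -
  have "proper_fun (indicator_fun C)"
    using assms by (auto simp: proper_fun_def indicator_fun_def)
  moreover have "lower_semicontinuous (indicator_fun C)"
    unfolding lower_semicontinuous_def
  proof (intro allI impI)
    fix x r assume r: "r < indicator_fun C x"
    show "\<forall>\<^sub>F y in nhds x. r < indicator_fun C y"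
    proof (cases "x \<in> C")
      case True
      then have "r < indicator_fun C y" for y
        using r by (auto simp: indicator_fun_def intro: less_le_trans)
      then show ?thesis by simp
    next
      case False
      then have "\<forall>\<^sub>F y in nhds x. y \<in> - C"
        using assms by (intro eventually_nhds_in_open) auto
      then show ?thesis
        by eventually_elim (use r False in \<open>auto simp: indicator_fun_def\<close>)
    qed
  qed
  moreover have "convex_fun (indicator_fun C)"
    using assms(3) by (auto simp: convex_fun_def indicator_fun_def convex_alt)
  ultimately show ?thesis by (simp add: Gamma_fun_def)
qed

text \<open>
  This and \<open>feasible_if_char_cone_le\<close> say that the feasible points are exactly those whose evaluations
  are nonpositive on the cone, in the sense \<open>\<langle>v, x\<rangle> - a \<le> 0\<close>. This direction is the definition of the
  conjugates.
\<close>

lemma char_cone_le_at_feasible: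
  assumes x: "x \<in> feasible_set C I g" and va: "(v, a) \<in> char_cone C I g"
  shows "dual_apply v x \<le> a"
proof -
  have "convex_cone {(v, a). dual_apply v x \<le> a}"
    unfolding convex_cone_iff by (auto simp: zero_prod_def add_mono mult_left_mono)
  moreover have "dual_apply v x \<le> a" if "(v, a) \<in> epi (conjugate (g i))" "i \<in> I" for v a i
    using that x unfolding epi_conjugate_iff feasible_set_def zero_ereal_def by fastforce
  ultimately have "char_cone C I g \<subseteq> {(v, a). dual_apply v x \<le> a}"
    unfolding char_cone_def cone_gen_def
    using x by (intro hull_minimal) (auto simp: epi_support_iff feasible_set_def zero_prod_def)
  with va show ?thesis by blast
qed

text \<open>
  The converse is Fenchel-Moreau, applied to the indicator of \<open>C\<close> and to each constraint function.
\<close>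

lemma feasible_if_char_cone_le:
  fixes C :: "'a::locally_convex_space set"
  assumes C: "C \<noteq> {}" "closed C" "convex C" and g: "\<And>i. i \<in> I \<Longrightarrow> g i \<in> Gamma_fun"
    and le: "\<And>v a. (v, a) \<in> char_cone C I g \<Longrightarrow> dual_apply v x \<le> a"
  shows "x \<in> feasible_set C I g"
proof -
  have gen: "epi (conjugate (indicator_fun C)) \<union> (\<Union>i\<in>I. epi (conjugate (g i))) \<subseteq> char_cone C I g"
    unfolding char_cone_def cone_gen_def by (meson Un_upper1 hull_subset order_trans)
  have "indicator_fun C x \<le> ereal 0"
    by (rule fenchel_moreau[OF indicator_fun_in_Gamma_fun[OF C]]) (use le gen in auto)
  then have "x \<in> C" by (auto simp: indicator_fun_def split: if_splits)
  moreover have "g i x \<le> ereal 0" if "i \<in> I" for i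
    by (rule fenchel_moreau[OF g[OF that]]) (use le gen that in auto)
  ultimately show ?thesis by (simp add: feasible_set_def zero_ereal_def)
qed

text \<open>
  The epigraph of the support function is itself a convex cone and needs no multiplier. A
  representation over an empty \<open>J\<close> is padded by an index of \<open>I\<close> with multiplier \<open>0\<close>, for which some
  element of the epigraph of its conjugate must exist; that is an affine minorant.
\<close>

lemma char_cone_decomposition:
  fixes g :: "'i \<Rightarrow> 'a::locally_convex_space \<Rightarrow> ereal"
  assumes I: "I \<noteq> {}" and g: "\<And>i. i \<in> I \<Longrightarrow> g i \<in> Gamma_fun" and p: "p \<in> char_cone C I g"
  obtains J l q e where "finite J" "J \<noteq> {}" "J \<subseteq> I"
    "\<forall>j\<in>J. l j \<ge> 0 \<and> q j \<in> epi (conjugate (g j))" "e \<in> epi (conjugate (indicator_fun C))"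
    "p = e + (\<Sum>j\<in>J. l j *\<^sub>R q j)"
proof -
  let ?B = "epi (conjugate (indicator_fun C))" and ?S = "\<lambda>i. epi (conjugate (g i))"
  have ne: "?S i \<noteq> {}" if "i \<in> I" for i
    using Gamma_fun_affine_minorant[OF g[OF that]] by blast
  have "0 \<in> ?B"
    by (rule convex_cone_contains_0[OF convex_cone_epi_support])
  then have "?B \<union> (\<Union>i\<in>I. ?S i) \<union> {0} = ?B \<union> (\<Union>i\<in>I. ?S i)" by blast
  then have "p \<in> convex_cone hull (?B \<union> (\<Union>i\<in>I. ?S i))"
    using p by (simp add: char_cone_def cone_gen_def)
  then obtain e k where e: "e \<in> convex_cone hull ?B" and k: "k \<in> convex_cone hull (\<Union>i\<in>I. ?S i)"
    and p_eq: "p = e + k"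
    unfolding convex_cone_hull_Un by blast
  have e: "e \<in> ?B"
    using e hull_same[of convex_cone ?B] convex_cone_epi_support by auto
  obtain J l q where J: "finite J" "J \<subseteq> I" "\<And>j. j \<in> J \<Longrightarrow> l j \<ge> 0" "\<And>j. j \<in> J \<Longrightarrow> q j \<in> ?S j"
    "k = (\<Sum>j\<in>J. l j *\<^sub>R q j)"
    using convex_cone_hull_UN_convex[of I ?S, OF convex_epi_conjugate ne k] by blast
  show thesis
  proof (cases "J = {}")
    case True
    obtain i where i: "i \<in> I" using I by blast
    obtain q0 where "q0 \<in> ?S i" using ne[OF i] by blast
    then show thesis
      using i e p_eq J(5) True by (intro that[of "{i}" "\<lambda>_. 0" "\<lambda>_. q0" e]) auto
  qed (use that J e p_eq in blast)
qed


section \<open>Separating from the sum of epigraph and cone; multipliers\<close>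

text \<open>
  The core of the argument. A point \<open>(xs, - s)\<close> outside the closed convex set \<open>E = epi f\<^sup>* + K\<close> could be
  separated from it by an evaluation; the feasible point \<open>x0\<close> of the domain of \<open>f\<close> provides the
  minorant that makes the separation non-vertical, of the form \<open>\<langle>u, w\<rangle> \<le> t + r\<close> on \<open>E\<close> with
  \<open>t < \<langle>xs, w\<rangle> + s\<close>. Moving along the cone \<open>K\<close> shows that \<open>w\<close> is feasible, and restricting to \<open>epi f\<^sup>*\<close> gives
  \<open>f w \<le> t\<close> by Fenchel-Moreau. So \<open>w\<close> violates the assumed lower bound.
\<close>

lemma mem_epi_conjugate_plus_char_cone:
  fixes C :: "'a::locally_convex_space set"
  assumes C: "C \<noteq> {}" "closed C" "convex C" and g: "\<And>i. i \<in> I \<Longrightarrow> g i \<in> Gamma_fun"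
    and f: "f \<in> Gamma_fun" and x0: "x0 \<in> feasible_set C I g" "x0 \<in> eff_dom f"
    and cl: "closed (epi (conjugate f) + char_cone C I g)"
    and lb: "\<And>x. x \<in> feasible_set C I g \<Longrightarrow> ereal s \<le> f x - ereal (dual_apply xs x)"
  shows "(xs, - s) \<in> epi (conjugate f) + char_cone C I g"
proof (rule ccontr)
  define K where "K = char_cone C I g"
  define E where "E = epi (conjugate f) + K"
  assume "\<not> ?thesis"
  then have notin: "(xs, - s) \<notin> E" by (simp add: E_def K_def)
  have K: "convex_cone K"
    by (simp add: K_def char_cone_def cone_gen_def convex_cone_convex_cone_hull)
  have "convex E"
    unfolding E_def using K
    by (intro convex_set_plus convex_epi_conjugate) (simp add: convex_cone_def)
  have E_I: "(u + v, r + a) \<in> E" if "(u, r) \<in> epi (conjugate f)" "(v, a) \<in> K" for u r v a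
    using set_plus_intro[OF that] by (simp add: E_def)
  obtain u1 r1 where u1: "(u1, r1) \<in> epi (conjugate f)"
    using Gamma_fun_affine_minorant[OF f] by blast
  have epi_E: "epi (conjugate f) \<subseteq> E"
    using E_I[of _ _ 0 0] convex_cone_contains_0[OF K] by (auto simp: zero_prod_def)
  with u1 have "E \<noteq> {}" by blast
  obtain y b where sep: "\<And>u r. (u, r) \<in> E \<Longrightarrow> 1 \<le> dual_apply (u - xs) y + b * (r - - s)"
    using weak_star_separation[OF cl[folded K_def, folded E_def] \<open>convex E\<close> \<open>E \<noteq> {}\<close> notin] by blast
  \<comment> \<open>raising the real coordinate does not leave \<open>E\<close>, so its coefficient cannot be negative\<close>
  have "b \<ge> 0"
  proof (rule ccontr)
    assume "\<not> b \<ge> 0"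
    define d where "d = dual_apply (u1 - xs) y + b * (r1 + s)"
    define t where "t = max 0 (d / (- b))"
    have "(u1, r1 + t) \<in> epi (conjugate f)"
      using u1 by (force simp: epi_conjugate_iff t_def)
    then have "1 \<le> d + b * t"
      using sep[of u1 "r1 + t"] epi_E by (auto simp: d_def algebra_simps)
    moreover have "b * t \<le> b * (d / (- b))"
      using \<open>\<not> b \<ge> 0\<close> by (intro mult_left_mono_neg) (auto simp: t_def)
    ultimately show False using \<open>\<not> b \<ge> 0\<close> by simp
  qed
  obtain F where F: "f x0 = ereal F"
    using x0(2) Gamma_funD(1)[OF f, of x0] by (cases "f x0") (auto simp: eff_dom_def)
  have minor: "- F \<le> dual_apply u (- x0) + r" if "(u, r) \<in> E" for u r
  proof -
    obtain u' r' v a where *: "(u', r') \<in> epi (conjugate f)" "(v, a) \<in> K" "u = u' + v" "r = r' + a"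
      using \<open>(u, r) \<in> E\<close> by (auto simp: E_def elim!: set_plus_elim)
    have "dual_apply u' x0 \<le> F + r'"
      using *(1) F by (simp add: epi_conjugate_iff)
    moreover have "dual_apply v x0 \<le> a"
      using char_cone_le_at_feasible[OF x0(1)] *(2) by (simp add: K_def)
    ultimately show ?thesis
      using * by (simp add: linear_neg[OF linear_dual_apply])
  qed
  obtain \<alpha> \<beta> \<eta> where \<eta>: "\<eta> > 0" and tilt: "\<And>u r. (u, r) \<in> E \<Longrightarrow>
      \<alpha> * dual_apply xs (- x0) + \<beta> * dual_apply xs y + - s + \<eta>
        \<le> \<alpha> * dual_apply u (- x0) + \<beta> * dual_apply u y + r"
    by (rule nonvertical_separation[of "\<lambda>u. dual_apply u y" b E xs "- s" "- F" "\<lambda>u. dual_apply u (- x0)"])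
      (use linear_eval \<open>b \<ge> 0\<close> sep minor that in auto)
  \<comment> \<open>the tilted functional is the evaluation at \<open>- w\<close>\<close>
  define w where "w = \<alpha> *\<^sub>R x0 - \<beta> *\<^sub>R y"
  define t where "t = dual_apply xs w + s - \<eta>"
  have w: "dual_apply u w \<le> t + r" if "(u, r) \<in> E" for u r
    using tilt[OF that]
    by (simp add: w_def t_def linear_diff[OF linear_dual_apply] linear_cmul[OF linear_dual_apply]
        linear_neg[OF linear_dual_apply])
  \<comment> \<open>otherwise adding a large multiple of \<open>(v, a)\<close> to \<open>(u1, r1)\<close> would violate the bound on \<open>E\<close>\<close>
  have "dual_apply v w \<le> a" if va: "(v, a) \<in> K" for v a
  proof (rule ccontr)
    assume "\<not> dual_apply v w \<le> a"
    then have d: "dual_apply v w - a > 0" (is "?d > 0") by simp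
    define n where "n = max 0 ((t + r1 - dual_apply u1 w + 1) / ?d)"
    have "(n *\<^sub>R v, n * a) \<in> K"
      using convex_cone_scaleR[OF K _ va, of n] by (simp add: n_def)
    from w[OF E_I[OF u1 this]] have "n * ?d \<le> t + r1 - dual_apply u1 w"
      by (simp add: algebra_simps)
    moreover have "(t + r1 - dual_apply u1 w + 1) / ?d * ?d \<le> n * ?d"
      using d by (intro mult_right_mono) (auto simp: n_def)
    ultimately show False using d by simp
  qed
  then have "w \<in> feasible_set C I g"
    by (intro feasible_if_char_cone_le[OF C g]) (auto simp: K_def)
  then have "ereal s \<le> f w - ereal (dual_apply xs w)" by (rule lb)
  moreover have "f w \<le> ereal t"
    by (rule fenchel_moreau[OF f]) (use w epi_E in blast)
  ultimately show False
    using \<eta> by (cases "f w") (auto simp: t_def)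
qed

lemma conjugate_finite:
  assumes h: "h \<in> Gamma_fun" and u: "u \<in> eff_dom (conjugate h)"
  obtains r where "conjugate h u = ereal r"
proof (cases "conjugate h u")
  case MInf
  obtain z t where z: "h z \<le> ereal t"
    using Gamma_funD(3)[OF h] by (auto simp: epi_def)
  have "(u, dual_apply u z - t - 1) \<in> epi (conjugate h)"
    by (simp add: epi_def MInf)
  with z have "dual_apply u z \<le> t + (dual_apply u z - t - 1)"
    unfolding epi_conjugate_iff by blast
  then show thesis by simp
qed (use u that in \<open>auto simp: eff_dom_def\<close>)

lemma fenchel_young:
  assumes "conjugate h u = ereal r"
  shows "ereal (dual_apply u x - r) \<le> h x"
proof -
  have "(u, r) \<in> epi (conjugate h)" using assms by (simp add: epi_def)
  then have le: "dual_apply u x \<le> t + r" if "h x \<le> ereal t" for t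
    using that unfolding epi_conjugate_iff by blast
  show ?thesis
  proof (rule ereal_le_real)
    fix t assume "h x \<le> ereal t"
    from le[OF this] show "ereal (dual_apply u x - r) \<le> ereal t" by simp
  qed
qed

lemma multipliers_if_mem_epi_conjugate_plus:
  fixes C :: "'a::locally_convex_space set"
  assumes I: "I \<noteq> {}" and g: "\<And>i. i \<in> I \<Longrightarrow> g i \<in> Gamma_fun"
    and mem: "(xs, - s) \<in> epi (conjugate f) + char_cone C I g"
  shows "\<exists>J u l us vs. finite J \<and> J \<noteq> {} \<and> J \<subseteq> I
         \<and> (\<forall>j\<in>J. u j \<in> eff_dom (conjugate (g j)) \<and> (l j :: real) \<ge> 0)
         \<and> us \<in> eff_dom (conjugate f) \<and> vs \<in> barr C
         \<and> xs = us + vs + (\<Sum>j\<in>J. l j *\<^sub>R u j)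
         \<and> conjugate f us + conjugate (indicator_fun C) vs
             + (\<Sum>j\<in>J. ereal (l j) * conjugate (g j) (u j)) \<le> - ereal s"
proof -
  obtain us r0 k where us: "(us, r0) \<in> epi (conjugate f)" and k: "k \<in> char_cone C I g"
    and eq: "(xs, - s) = (us, r0) + k"
    using mem by (auto elim!: set_plus_elim)
  obtain J l q e where J: "finite J" "J \<noteq> {}" "J \<subseteq> I"
    and q: "\<forall>j\<in>J. l j \<ge> 0 \<and> q j \<in> epi (conjugate (g j))"
    and e: "e \<in> epi (conjugate (indicator_fun C))" and k_eq: "k = e + (\<Sum>j\<in>J. l j *\<^sub>R q j)"
    using char_cone_decomposition[OF I g k] by blast
  obtain vs a where va: "e = (vs, a)" by fastforce
  have q': "conjugate (g j) (fst (q j)) \<le> ereal (snd (q j))" if "j \<in> J" for j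
    using q that by (auto simp: epi_def)
  have "conjugate f us + conjugate (indicator_fun C) vs
      + (\<Sum>j\<in>J. ereal (l j) * conjugate (g j) (fst (q j)))
    \<le> ereal r0 + ereal a + (\<Sum>j\<in>J. ereal (l j) * ereal (snd (q j)))"
    using us e va q' q by (intro add_mono sum_mono ereal_mult_left_mono) (auto simp: epi_def)
  also have "\<dots> = - ereal s"
    using arg_cong[OF eq, of snd] by (simp add: k_eq va snd_sum)
  finally have "conjugate f us + conjugate (indicator_fun C) vs
      + (\<Sum>j\<in>J. ereal (l j) * conjugate (g j) (fst (q j))) \<le> - ereal s" .
  moreover have "xs = us + vs + (\<Sum>j\<in>J. l j *\<^sub>R fst (q j))"
    using arg_cong[OF eq, of fst] by (simp add: k_eq va fst_sum add.assoc)
  moreover have "us \<in> eff_dom (conjugate f)" "vs \<in> barr C"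
    using us e va by (auto simp: epi_def eff_dom_def barr_def intro: le_less_trans)
  moreover have "fst (q j) \<in> eff_dom (conjugate (g j))" if "j \<in> J" for j
    using q'[OF that] by (auto simp: eff_dom_def intro: le_less_trans)
  ultimately show ?thesis
    using J q by (intro exI[of _ J] exI[of _ "\<lambda>j. fst (q j)"] exI[of _ l] exI[of _ us] exI[of _ vs]) auto
qed

text \<open>
  Add up the Fenchel-Young inequalities of \<open>f\<close>, of the indicator of \<open>C\<close> and of the \<open>g j\<close>, the latter
  multiplied by \<open>l j\<close>. The linear parts add up to \<open>xs\<close>.
\<close>

lemma lagrangian_bound_if_multipliers:
  fixes C :: "'a::locally_convex_space set"
  assumes C: "indicator_fun C \<in> Gamma_fun" and g: "\<And>i. i \<in> J \<Longrightarrow> g i \<in> Gamma_fun"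
    and f: "f \<in> Gamma_fun" and "finite J"
    and u: "\<And>j. j \<in> J \<Longrightarrow> u j \<in> eff_dom (conjugate (g j))" "\<And>j. j \<in> J \<Longrightarrow> l j \<ge> 0"
    and us: "us \<in> eff_dom (conjugate f)" and vs: "vs \<in> barr C"
    and xs: "xs = us + vs + (\<Sum>j\<in>J. l j *\<^sub>R u j)"
    and le: "conjugate f us + conjugate (indicator_fun C) vs
             + (\<Sum>j\<in>J. ereal (l j) * conjugate (g j) (u j)) \<le> - ereal s"
    and x: "x \<in> C"
  shows "ereal s \<le> f x - ereal (dual_apply xs x) + (\<Sum>i\<in>J. ereal (l i) * g i x)"
proof -
  obtain r0 where r0: "conjugate f us = ereal r0"
    using conjugate_finite[OF f us] by blast
  obtain a where a: "conjugate (indicator_fun C) vs = ereal a"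
    using conjugate_finite[OF C] vs unfolding barr_def by blast
  have "\<forall>j\<in>J. \<exists>r. conjugate (g j) (u j) = ereal r"
    using conjugate_finite[OF g u(1)] by metis
  then obtain r where r: "\<And>j. j \<in> J \<Longrightarrow> conjugate (g j) (u j) = ereal (r j)"
    by metis
  have "(\<Sum>j\<in>J. ereal (l j) * conjugate (g j) (u j)) = ereal (\<Sum>j\<in>J. l j * r j)"
    using r by simp
  with le r0 a have le': "r0 + a + (\<Sum>j\<in>J. l j * r j) \<le> - s" by simp
  have "dual_apply vs x \<le> a"
    using fenchel_young[OF a, of x] x by (simp add: indicator_fun_def zero_ereal_def)
  then have "s \<le> dual_apply us x - r0 - dual_apply xs x + (\<Sum>j\<in>J. l j * (dual_apply (u j) x - r j))"
    using le' by (simp add: xs dual_apply_sum right_diff_distrib sum_subtractf)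
  then have "ereal s \<le> ereal (dual_apply us x - r0) - ereal (dual_apply xs x)
      + (\<Sum>j\<in>J. ereal (l j) * ereal (dual_apply (u j) x - r j))"
    by simp
  also have "\<dots> \<le> f x - ereal (dual_apply xs x) + (\<Sum>i\<in>J. ereal (l i) * g i x)"
    using fenchel_young r0 r u(2)
    by (intro add_mono ereal_minus_mono sum_mono ereal_mult_left_mono) auto
  finally show ?thesis .
qed

lemma lower_bound_if_lagrangian_bound:
  assumes "\<And>i. i \<in> J \<Longrightarrow> (l i :: real) \<ge> 0" "\<And>i. i \<in> J \<Longrightarrow> g i x \<le> (0::ereal)"
    and "ereal s \<le> c + (\<Sum>i\<in>J. ereal (l i) * g i x)"
  shows "ereal s \<le> c"
proof -
  have "ereal (l i) * g i x \<le> ereal (l i) * 0" if "i \<in> J" for i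
    using assms that by (intro ereal_mult_left_mono) auto
  then have "(\<Sum>i\<in>J. ereal (l i) * g i x) \<le> 0"
    by (intro sum_nonpos) simp
  then have "c + (\<Sum>i\<in>J. ereal (l i) * g i x) \<le> c + 0"
    by (intro add_left_mono)
  with assms(3) show ?thesis by (metis add.right_neutral order_trans)
qed

theorem theorem4p2:
  fixes I :: "'i set"
    and C :: "'a::locally_convex_space set"
    and g :: "'i \<Rightarrow> 'a \<Rightarrow> ereal"
    and f :: "'a \<Rightarrow> ereal"
    and xs :: "'a dual"
    and s :: real
  assumes "I \<noteq> {}"
    and "C \<noteq> {}" and "closed C" and "convex C"
    and "\<And>i. i \<in> I \<Longrightarrow> g i \<in> Gamma_fun"
    and "f \<in> Gamma_fun"
    and "feasible_set C I g \<inter> eff_dom f \<noteq> {}"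
    and "closed (epi (conjugate f) + char_cone C I g)"
  shows
    "((\<forall>x\<in>C. (\<forall>i\<in>I. g i x \<le> 0) \<longrightarrow> f x - ereal (dual_apply xs x) \<ge> ereal s)
       \<longleftrightarrow>
      (\<exists>J u l us vs. finite J \<and> J \<noteq> {} \<and> J \<subseteq> I
         \<and> (\<forall>j\<in>J. u j \<in> eff_dom (conjugate (g j)) \<and> (l j :: real) \<ge> 0)
         \<and> us \<in> eff_dom (conjugate f) \<and> vs \<in> barr C
         \<and> xs = us + vs + (\<Sum>j\<in>J. l j *\<^sub>R u j)
         \<and> conjugate f us + conjugate (indicator_fun C) vs
             + (\<Sum>j\<in>J. ereal (l j) * conjugate (g j) (u j)) \<le> - ereal s))
     \<and>
     ((\<forall>x\<in>C. (\<forall>i\<in>I. g i x \<le> 0) \<longrightarrow> f x - ereal (dual_apply xs x) \<ge> ereal s)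
       \<longleftrightarrow>
      (\<exists>J l. finite J \<and> J \<noteq> {} \<and> J \<subseteq> I \<and> (\<forall>i\<in>J. (l i :: real) \<ge> 0)
         \<and> (\<forall>x\<in>C. f x - ereal (dual_apply xs x) + (\<Sum>i\<in>J. ereal (l i) * g i x) \<ge> ereal s)))"
    (is "(?i \<longleftrightarrow> ?ii) \<and> (?i \<longleftrightarrow> ?iii)")
proof -
  have i_ii: "?ii" if ?i
  proof (rule multipliers_if_mem_epi_conjugate_plus[OF assms(1,5)])
    obtain x0 where "x0 \<in> feasible_set C I g" "x0 \<in> eff_dom f"
      using assms(7) by blast
    then show "(xs, - s) \<in> epi (conjugate f) + char_cone C I g"
      using \<open>?i\<close> by (intro mem_epi_conjugate_plus_char_cone[OF assms(2-6) _ _ assms(8)])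
        (auto simp: feasible_set_def)
  qed
  have ii_iii: "?iii" if ?ii
  proof -
    from that obtain J u l us vs where J: "finite J" "J \<noteq> {}" "J \<subseteq> I"
      "\<forall>j\<in>J. u j \<in> eff_dom (conjugate (g j)) \<and> (l j :: real) \<ge> 0"
      and *: "us \<in> eff_dom (conjugate f)" "vs \<in> barr C" "xs = us + vs + (\<Sum>j\<in>J. l j *\<^sub>R u j)"
        "conjugate f us + conjugate (indicator_fun C) vs
             + (\<Sum>j\<in>J. ereal (l j) * conjugate (g j) (u j)) \<le> - ereal s"
      by (elim exE conjE)
    have "ereal s \<le> f x - ereal (dual_apply xs x) + (\<Sum>i\<in>J. ereal (l i) * g i x)" if "x \<in> C" for x
      by (rule lagrangian_bound_if_multipliers[OF indicator_fun_in_Gamma_fun[OF assms(2-4)]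
            _ assms(6) J(1) _ _ * that]) (use J assms(5) in auto)
    then show ?iii
      using J by (intro exI[of _ J] exI[of _ l] conjI ballI) auto
  qed
  have iii_i: "?i" if ?iii
  proof (intro ballI impI)
    fix x assume x: "x \<in> C" "\<forall>i\<in>I. g i x \<le> 0"
    from that obtain J l where J: "J \<subseteq> I" and l: "\<forall>i\<in>J. (l i :: real) \<ge> 0"
      and bound: "\<forall>x\<in>C. ereal s \<le> f x - ereal (dual_apply xs x) + (\<Sum>i\<in>J. ereal (l i) * g i x)"
      by (elim exE conjE)
    show "ereal s \<le> f x - ereal (dual_apply xs x)"
    proof (rule lower_bound_if_lagrangian_bound)
      show "l i \<ge> 0" "g i x \<le> 0" if "i \<in> J" for i
        using that J l x(2) by blast+
      show "ereal s \<le> f x - ereal (dual_apply xs x) + (\<Sum>i\<in>J. ereal (l i) * g i x)"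
        using bound x(1) by (rule bspec)
    qed
  qed
  show ?thesis
  proof (intro conjI iffI)
    show ?ii if ?i using that by (rule i_ii)
    show ?i if ?ii using ii_iii[OF that] by (rule iii_i)
    show ?iii if ?i using i_ii[OF that] by (rule ii_iii)
    show ?i if ?iii using that by (rule iii_i)
  qed
qed

end
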